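(* Let $A,B\in\mathbb{C}^{n\times n}$, $a<b$, $\gamma$, $\rho$, $m$, $r$, $L$, $M$, $N$, $X=[\boldsymbol{x}_1,\dots,\boldsymbol{x}_n]$, $\lambda_k$ be as in the context, with $m<r$. Let $V\in\mathbb{C}^{n\times L}$ be an arbitrary matrix such that $$V = [X_0, X_1]\begin{bmatrix} C_0\\ C_1\end{bmatrix},$$ where the columns of $X_0=[\boldsymbol{x}_{r+1},\dots,\boldsymbol{x}_n]$ form a basis of $\mathrm{Ker}\,B$, the columns of $X_1=[\boldsymbol{x}_1,\dots,\boldsymbol{x}_r]$ form a basis of $(\mathrm{Ker}\,B)^\perp$, $C_0\in\mathbb{C}^{(n-r)\times L}$, and $C_1\in\mathbb{C}^{r\times L}$ has at least one nonzero entry in each column and each row. Suppose $N>2M-1\ge p$ and that $\hat\lambda$ satisfies $|\hat\lambda-\gamma| = \min_{k=m+1,\dots,r}|\lambda_k-\gamma|$. Then, for $p=0,1,\dots,2M-1$, the matrix $\mathsf{M}_{p,\mathrm{out}}^{(N)}$ defined in the context satisfies, entrywise, $$\left|\mathsf{M}_{p,\mathrm{out}}^{(N)}\right| \le (r-m)\,|\hat\lambda-\gamma|^{p}\,\frac{\left(\frac{\rho}{|\hat\lambda-\gamma|}\right)^N}{1-\left(\frac{\rho}{|\hat\lambda-\gamma|}\right)^N}\,\left\|V^{\mathsf H}BV\right\|_{\mathsf F},$$ where $\|\cdot\|_{\mathsf F}$ is the Frobenius norm.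
   Context: Setting. $A = A^{\mathsf H} \in \mathbb{C}^{n\times n}$; $B = B^{\mathsf H}\in\mathbb{C}^{n\times n}$ is positive semidefinite with $r = \mathrm{rank}\, B$; the pencil $zB-A$ is regular, i.e. $\det(zB-A)$ is not identically zero. There is a nonsingular $X = [\boldsymbol{x}_1,\dots,\boldsymbol{x}_n]\in\mathbb{C}^{n\times n}$ with $X^{\mathsf H}(zB-A)X = z\mathrm{I}_0 - \Lambda$ for all $z \in \mathbb{C}$, where $\mathrm{I}_0$ is diagonal with leading $r$ diagonal entries equal to $1$ and the other $n-r$ equal to $0$, and $\Lambda$ is diagonal with leading $r$ diagonal entries the eigenvalues $\lambda_1,\dots,\lambda_r\in\mathbb{R}$ of $A\boldsymbol{x}=\lambda B\boldsymbol{x}$ and trailing $n-r$ diagonal entries nonzero. In particular $X^{\mathsf H}BX=\mathrm{I}_0$ and $\boldsymbol{x}_k$ is an eigenvector for $\lambda_k$ ($k\le r$). $[a,b]\subset\mathbb{R}$ with $a<b$ is an interval whose endpoints are not eigenvalues; the eigenvalues (with multiplicity) in $[a,b]$ are $\lambda_1,\dots,\lambda_m$, and $\lambda_{m+1},\dots,\lambda_r$ lie outside $[a,b]$. Put $\gamma = (a+b)/2$ and $\rho=(b-a)/2$. $L,M,N$ are positive integers. For $V\in\mathbb{C}^{n\times L}$ put $\mathcal{V}_k = V^{\mathsf H}B\boldsymbol{x}_k\boldsymbol{x}_k^{\mathsf H}BV\in\mathbb{C}^{L\times L}$ and $$\mathsf{M}_{p,\mathrm{out}}^{(N)} = \sum_{k=m+1}^r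 (\lambda_k-\gamma)^p\,\frac{-\left(\frac{\rho}{\lambda_k-\gamma}\right)^N}{1-\left(\frac{\rho}{\lambda_k-\gamma}\right)^N}\,\mathcal{V}_k ,$$ the contribution of the eigenvalues outside $[a,b]$ to the $N$-point trapezoidal approximation of the $p$th complex moment $\frac{1}{2\pi\mathrm{i}}\oint_{|z-\gamma|=\rho}(z-\gamma)^pV^{\mathsf H}B(zB-A)^{-1}BV\,\mathrm{d}z$. For a matrix $C=(c_{ij})$, $|C|=(|c_{ij}|)$ entrywise; for a real matrix $C$ and a scalar $\alpha$, $C\le\alpha$ means that every entry of $C$ is at most $\alpha$. *)

theory Defs
  imports
    "Jordan_Normal_Form.Schur_Decomposition"
    "Jordan_Normal_Form.DL_Rank"
    "Jordan_Normal_Form.Matrix_Kernel"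
begin

text \<open>
  Indices are 0-based, following the matrix library: the vector written
  \<open>x\<^sub>k\<close> on paper is \<open>col X (k - 1)\<close>, and the eigenvalue \<open>\<lambda>\<^sub>k\<close> is \<open>lam (k - 1)\<close>.
\<close>

definition hermitian_mat :: "complex mat \<Rightarrow> bool" where
  "hermitian_mat A \<longleftrightarrow> mat_adjoint A = A"

text \<open>
  \<open>(B *\<^sub>v x) \<bullet>c x\<close> is the quadratic form of \<open>B\<close>, since \<open>\<bullet>c\<close> conjugates its
  second argument. The order on the complex numbers is the one in which
  \<open>0 \<le> z\<close> means that \<open>z\<close> is real and nonnegative.
\<close>
definition psd_mat :: "complex mat \<Rightarrow> bool" where
  "psd_mat B \<longleftrightarrow> hermitian_mat B \<and>
     (\<forall>x \<in> carrier_vec (dim_row B). 0 \<le> (B *\<^sub>v x) \<bullet>c x)"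

definition pencil :: "complex mat \<Rightarrow> complex mat \<Rightarrow> complex \<Rightarrow> complex mat" where
  "pencil A B z = z \<cdot>\<^sub>m B - A"

definition regular_pencil :: "complex mat \<Rightarrow> complex mat \<Rightarrow> bool" where
  "regular_pencil A B \<longleftrightarrow> (\<exists>z. det (pencil A B z) \<noteq> 0)"

definition pencil_eigenvalue :: "complex mat \<Rightarrow> complex mat \<Rightarrow> complex \<Rightarrow> bool" where
  "pencil_eigenvalue A B z \<longleftrightarrow>
     (\<exists>x \<in> carrier_vec (dim_row A). x \<noteq> 0\<^sub>v (dim_row A) \<and> A *\<^sub>v x = z \<cdot>\<^sub>v (B *\<^sub>v x))"

definition partial_id_mat :: "nat \<Rightarrow> nat \<Rightarrow> complex mat" where
  "partial_id_mat n r = mat n n (\<lambda>(i, j). if i = j \<and> i < r then 1 else 0)"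

text \<open>
  The congruence below forces \<open>lam 0, \<dots>, lam (r - 1)\<close> to be the finite eigenvalues of
  \<open>A x = \<lambda> B x\<close> with multiplicity: \<open>det (z B - A)\<close> is a nonzero constant times
  the product of the \<open>z - lam k\<close> over \<open>k < r\<close>.
\<close>
definition pencil_canonical_form ::
  "nat \<Rightarrow> nat \<Rightarrow> complex mat \<Rightarrow> complex mat \<Rightarrow> complex mat \<Rightarrow> complex mat \<Rightarrow> (nat \<Rightarrow> real) \<Rightarrow> bool" where
  "pencil_canonical_form n r A B X Lam lam \<longleftrightarrow>
     X \<in> carrier_mat n n \<and> invertible_mat X \<and>
     Lam \<in> carrier_mat n n \<and> diagonal_mat Lam \<and>
     (\<forall>k<r. Lam $$ (k, k) = complex_of_real (lam k)) \<and>
     (\<forall>k\<in>{r..<n}. Lam $$ (k, k) \<noteq> 0) \<and>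
     (\<forall>z. mat_adjoint X * pencil A B z * X = z \<cdot>\<^sub>m partial_id_mat n r - Lam)"

text \<open>
  The library's \<open>orthogonal_complement\<close> uses the bilinear product; here the
  Hermitian one is needed.
\<close>
definition herm_orth_complement :: "nat \<Rightarrow> complex vec set \<Rightarrow> complex vec set" where
  "herm_orth_complement n W = {x \<in> carrier_vec n. \<forall>y\<in>W. x \<bullet>c y = 0}"

definition cols_form_basis :: "nat \<Rightarrow> complex mat \<Rightarrow> complex vec set \<Rightarrow> bool" where
  "cols_form_basis n Y W \<longleftrightarrow> distinct (cols Y) \<and>
     vectorspace.basis class_ring (module_vec TYPE(complex) n\<lparr>carrier := W\<rparr>) (set (cols Y))"

definition append_cols :: "complex mat \<Rightarrow> complex mat \<Rightarrow> complex mat" where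
  "append_cols Y Z = four_block_mat Y Z (0\<^sub>m 0 (dim_col Y)) (0\<^sub>m 0 (dim_col Z))"

text \<open>The matrix \<open>V\<^sup>H B x x\<^sup>H B V\<close>, with the vector \<open>x\<close> read as a one-column matrix.\<close>
definition moment_term :: "complex mat \<Rightarrow> complex mat \<Rightarrow> complex vec \<Rightarrow> complex mat" where
  "moment_term B V x = (let xc = mat_of_cols (dim_vec x) [x] in
     mat_adjoint V * B * xc * mat_adjoint xc * B * V)"

definition moment_out ::
  "nat \<Rightarrow> nat \<Rightarrow> real \<Rightarrow> real \<Rightarrow> (nat \<Rightarrow> real) \<Rightarrow> complex mat \<Rightarrow> complex mat \<Rightarrow> complex mat
     \<Rightarrow> nat \<Rightarrow> nat \<Rightarrow> complex mat" where
  "moment_out m r \<gamma> \<rho> lam B X V N p =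
     mat (dim_col V) (dim_col V) (\<lambda>ij. \<Sum>k\<in>{m..<r}.
       (complex_of_real ((lam k - \<gamma>) ^ p *
          (- ((\<rho> / (lam k - \<gamma>)) ^ N) / (1 - (\<rho> / (lam k - \<gamma>)) ^ N)))
        \<cdot>\<^sub>m moment_term B V (col X k)) $$ ij)"

definition abs_mat :: "complex mat \<Rightarrow> real mat" where
  "abs_mat C = map_mat cmod C"

definition mat_le_scalar :: "real mat \<Rightarrow> real \<Rightarrow> bool" where
  "mat_le_scalar C \<alpha> \<longleftrightarrow> (\<forall>i<dim_row C. \<forall>j<dim_col C. C $$ (i, j) \<le> \<alpha>)"

definition frobenius_norm :: "complex mat \<Rightarrow> real" where
  "frobenius_norm C = sqrt (\<Sum>i<dim_row C. \<Sum>j<dim_col C. (cmod (C $$ (i, j)))\<^sup>2)"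

end

theory Submission
  imports Defs
begin

text \<open>
  Write \<open>V = X Y\<close>. Since \<open>X\<^sup>H B X = I\<^sub>0\<close>, the entries of \<open>\<V>\<^sub>k\<close> are \<open>cnj (Y k i) * Y k j\<close>, while the
  \<open>i\<close>-th diagonal entry of \<open>V\<^sup>H B V\<close> is the sum of \<open>\<bar>Y k i\<bar>\<^sup>2\<close> over \<open>k < r\<close>. Hence every entry of
  \<open>\<V>\<^sub>k\<close> is bounded by the geometric mean of two diagonal entries of \<open>V\<^sup>H B V\<close>, and so by its
  Frobenius norm. The scalar weights are bounded by their value at the outer eigenvalue closest
  to \<open>\<gamma>\<close>, because \<open>d ^ p * (\<rho> / d) ^ N\<close> does not increase with \<open>d > \<rho>\<close> when \<open>p \<le> N\<close>.
\<close>

section \<open>Conjugate transposes of complex matrices\<close>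

lemma mat_adjoint_carrier: "A \<in> carrier_mat nr nc \<Longrightarrow> mat_adjoint A \<in> carrier_mat nc nr"
  unfolding mat_adjoint_def by auto

lemma mat_adjoint_index:
  fixes A :: "complex mat"
  assumes "i < dim_col A" "j < dim_row A"
  shows "mat_adjoint A $$ (i, j) = cnj (A $$ (j, i))"
  using assms unfolding mat_adjoint_def by (simp add: mat_of_rows_index)

lemma mat_adjoint_mult:
  fixes A B :: "complex mat"
  assumes A: "A \<in> carrier_mat nr k" and B: "B \<in> carrier_mat k nc"
  shows "mat_adjoint (A * B) = mat_adjoint B * mat_adjoint A"
proof (rule eq_matI)
  have AB: "A * B \<in> carrier_mat nr nc" using A B by simp
  have dims: "mat_adjoint (A * B) \<in> carrier_mat nc nr" "mat_adjoint A \<in> carrier_mat k nr"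
      "mat_adjoint B \<in> carrier_mat nc k"
    using A B AB by (auto intro: mat_adjoint_carrier)
  show "dim_row (mat_adjoint (A * B)) = dim_row (mat_adjoint B * mat_adjoint A)"
    "dim_col (mat_adjoint (A * B)) = dim_col (mat_adjoint B * mat_adjoint A)"
    using dims by auto
  fix i j assume "i < dim_row (mat_adjoint B * mat_adjoint A)"
    "j < dim_col (mat_adjoint B * mat_adjoint A)"
  then have ij: "i < nc" "j < nr" using dims by auto
  have "mat_adjoint (A * B) $$ (i, j) = cnj (\<Sum>l = 0..<k. A $$ (j, l) * B $$ (l, i))"
    using A B ij by (simp add: mat_adjoint_index scalar_prod_def)
  also have "\<dots> = (\<Sum>l = 0..<k. mat_adjoint B $$ (i, l) * mat_adjoint A $$ (l, j))"
    using A B ij by (simp add: mat_adjoint_index mult.commute)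
  also have "\<dots> = (mat_adjoint B * mat_adjoint A) $$ (i, j)"
    using A B ij dims by (simp add: scalar_prod_def)
  finally show "mat_adjoint (A * B) $$ (i, j) = (mat_adjoint B * mat_adjoint A) $$ (i, j)" .
qed

lemma mat_adjoint_adjoint:
  fixes A :: "complex mat"
  shows "mat_adjoint (mat_adjoint A) = A"
  using mat_adjoint_carrier[of A "dim_row A" "dim_col A"]
    mat_adjoint_carrier[OF mat_adjoint_carrier[of A "dim_row A" "dim_col A"]]
  by (intro eq_matI) (auto simp: mat_adjoint_index)

section \<open>Congruence of \<open>B\<close> and coordinates in the columns of
  \<open>X\<close>\<close>

lemma canonical_form_congruence:
  assumes A: "A \<in> carrier_mat n n" and B: "B \<in> carrier_mat n n"
    and can: "pencil_canonical_form n r A B X Lam lam"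
  shows "mat_adjoint X * B * X = partial_id_mat n r"
proof -
  have X: "X \<in> carrier_mat n n" and Lam: "Lam \<in> carrier_mat n n"
    and eq: "\<And>z. mat_adjoint X * pencil A B z * X = z \<cdot>\<^sub>m partial_id_mat n r - Lam"
    using can unfolding pencil_canonical_form_def by auto
  have I: "partial_id_mat n r \<in> carrier_mat n n"
    by (simp add: partial_id_mat_def)
  have AX: "mat_adjoint X \<in> carrier_mat n n" using X by (rule mat_adjoint_carrier)
  have P: "pencil A B z \<in> carrier_mat n n" for z
    unfolding pencil_def by (rule minus_carrier_mat[OF A])
  \<comment> \<open>The pencil is affine in \<open>z\<close> with slope \<open>B\<close>, so its
    values at 1 and 0 differ by exactly \<open>B\<close>. The same difference on the canonical side
    cancels \<open>Lam\<close>.\<close>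
  have "mat_adjoint X * B * X = mat_adjoint X * (pencil A B 1 - pencil A B 0) * X"
  proof -
    have "B = pencil A B 1 - pencil A B 0"
      using A B by (intro eq_matI) (auto simp: pencil_def)
    then show ?thesis by simp
  qed
  also have "\<dots> = mat_adjoint X * pencil A B 1 * X - mat_adjoint X * pencil A B 0 * X"
    by (simp only: mult_minus_distrib_mat[OF AX P P]
        minus_mult_distrib_mat[OF mult_carrier_mat[OF AX P] mult_carrier_mat[OF AX P] X])
  also have "\<dots> = (1 \<cdot>\<^sub>m partial_id_mat n r - Lam) - (0 \<cdot>\<^sub>m partial_id_mat n r - Lam)"
    by (simp only: eq)
  also have "\<dots> = partial_id_mat n r"
    using I Lam by (intro eq_matI) auto
  finally show ?thesis .
qed

lemma invertible_mat_factor: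
  fixes X V :: "'a::semiring_1 mat"
  assumes X: "X \<in> carrier_mat n n" "invertible_mat X" and V: "V \<in> carrier_mat n l"
  obtains Y where "Y \<in> carrier_mat n l" "V = X * Y"
proof -
  obtain Z where inv: "X * Z = 1\<^sub>m n" "Z * X = 1\<^sub>m (dim_row Z)"
    using X unfolding invertible_mat_def inverts_mat_def by auto
  \<comment> \<open>Invertibility gives no shape for \<open>Z\<close> directly; comparing the
    numbers of columns on both sides of the two identities shows that \<open>Z\<close> is square of
    size \<open>n\<close>.\<close>
  have "dim_col Z = n" "dim_row Z = n"
    using X arg_cong[OF inv(1), of dim_col] arg_cong[OF inv(2), of dim_col] by auto
  then have Z: "Z \<in> carrier_mat n n" by auto
  have "X * (Z * V) = V"
    using assoc_mult_mat[OF X(1) Z V] V inv by simp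
  with Z V show thesis by (intro that[of "Z * V"]) auto
qed

section \<open>Entries of the Gram matrix and of the moment terms\<close>

lemma partial_id_mult_index:
  assumes Y: "Y \<in> carrier_mat n l" and i: "i < l" and k: "k < n"
  shows "(mat_adjoint Y * partial_id_mat n r) $$ (i, k) = (if k < r then cnj (Y $$ (k, i)) else 0)"
proof -
  have "(mat_adjoint Y * partial_id_mat n r) $$ (i, k)
      = (\<Sum>s = 0..<n. mat_adjoint Y $$ (i, s) * partial_id_mat n r $$ (s, k))"
    using mat_adjoint_carrier[OF Y] i k by (simp add: scalar_prod_def partial_id_mat_def)
  also have "\<dots> = (\<Sum>s = 0..<n. if s = k then if k < r then cnj (Y $$ (k, i)) else 0 else 0)"
    using Y i k by (intro sum.cong) (auto simp: mat_adjoint_index partial_id_mat_def)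
  also have "\<dots> = (if k < r then cnj (Y $$ (k, i)) else 0)"
    using k by simp
  finally show ?thesis .
qed

lemma gram_diag_index:
  assumes r: "r \<le> n" and Y: "Y \<in> carrier_mat n l" and i: "i < l"
  shows "(mat_adjoint Y * partial_id_mat n r * Y) $$ (i, i)
    = complex_of_real (\<Sum>k<r. (cmod (Y $$ (k, i)))\<^sup>2)"
proof -
  have "(mat_adjoint Y * partial_id_mat n r * Y) $$ (i, i)
      = (\<Sum>k = 0..<n. (mat_adjoint Y * partial_id_mat n r) $$ (i, k) * Y $$ (k, i))"
    using mat_adjoint_carrier[OF Y] Y i by (simp add: scalar_prod_def partial_id_mat_def)
  also have "\<dots> = (\<Sum>k = 0..<n. if k < r then complex_of_real ((cmod (Y $$ (k, i)))\<^sup>2) else 0)"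
    by (intro sum.cong) (auto simp: partial_id_mult_index[OF Y i] complex_norm_square mult.commute
      simp del: of_real_power)
  also have "\<dots> = (\<Sum>k<r. complex_of_real ((cmod (Y $$ (k, i)))\<^sup>2))"
    using r by (intro sum.mono_neutral_cong_right) auto
  finally show ?thesis by simp
qed

text \<open>The matrix has the form \<open>P * mat_adjoint P\<close> for the single column
  \<open>P = mat_adjoint V * B * x\<close>, because \<open>B\<close> is its own adjoint.
  Substituting \<open>V = X * Y\<close> and using the congruence makes \<open>P\<close> the column
  \<open>k\<close> of \<open>mat_adjoint Y * partial_id_mat n r\<close>; since \<open>k < r\<close>,
  it is row \<open>k\<close> of \<open>Y\<close> conjugated.\<close>

lemma moment_term_index:
  assumes B: "B \<in> carrier_mat n n" "hermitian_mat B" and X: "X \<in> carrier_mat n n"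
    and cong: "mat_adjoint X * B * X = partial_id_mat n r"
    and Y: "Y \<in> carrier_mat n l" and V: "V = X * Y"
    and k: "k < n" "k < r" and i: "i < l" and j: "j < l"
  shows "moment_term B V (col X k) $$ (i, j) = cnj (Y $$ (k, i)) * Y $$ (k, j)"
proof -
  define x where "x = mat_of_cols n [col X k]"
  define P where "P = mat_adjoint V * B * x"
  have Vc: "V \<in> carrier_mat n l" using X Y V by simp
  have x: "x \<in> carrier_mat n 1" using mat_of_cols_carrier(1)[of n "[col X k]"] by (simp add: x_def)
  note adj = mat_adjoint_carrier[OF Vc] mat_adjoint_carrier[OF x] mat_adjoint_carrier[OF X]
    mat_adjoint_carrier[OF Y] mat_adjoint_carrier[OF B(1)]
  have P: "P \<in> carrier_mat l 1" using adj B x by (auto simp: P_def)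
  have adjP: "mat_adjoint P = mat_adjoint x * B * V"
  proof -
    have VB: "mat_adjoint V * B \<in> carrier_mat l n" using adj B by auto
    have "mat_adjoint P = mat_adjoint x * (mat_adjoint B * mat_adjoint (mat_adjoint V))"
      unfolding P_def by (simp add: mat_adjoint_mult[OF VB x] mat_adjoint_mult[OF adj(1) B(1)])
    also have "\<dots> = mat_adjoint x * (B * V)"
      using B(2) by (simp add: mat_adjoint_adjoint hermitian_mat_def)
    also have "\<dots> = mat_adjoint x * B * V"
      by (rule assoc_mult_mat[symmetric, OF adj(2) B(1) Vc])
    finally show ?thesis .
  qed
  have VBX: "mat_adjoint V * B * X = mat_adjoint Y * partial_id_mat n r"
  proof -
    have "mat_adjoint V * B * X = mat_adjoint Y * mat_adjoint X * B * X"
      by (simp add: V mat_adjoint_mult[OF X Y])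
    also have "\<dots> = mat_adjoint Y * (mat_adjoint X * B * X)"
      using assoc_mult_mat[OF adj(4,3) B(1)]
        assoc_mult_mat[OF adj(4) mult_carrier_mat[OF adj(3) B(1)] X] by simp
    finally show ?thesis by (simp add: cong)
  qed
  have Pi: "P $$ (s, 0) = cnj (Y $$ (k, s))" if s: "s < l" for s
  proof -
    have "P $$ (s, 0) = (mat_adjoint V * B * X) $$ (s, k)"
      using s k X x adj B by (simp add: P_def x_def)
    then show ?thesis using s k by (simp add: VBX partial_id_mult_index[OF Y])
  qed
  have "moment_term B V (col X k) = P * mat_adjoint x * B * V"
    using X by (simp add: moment_term_def P_def x_def Let_def)
  also have "\<dots> = P * mat_adjoint P"
    unfolding adjP
    using assoc_mult_mat[OF P adj(2) B(1)]
        assoc_mult_mat[OF P mult_carrier_mat[OF adj(2) B(1)] Vc] by simp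
  finally have "moment_term B V (col X k) $$ (i, j) = P $$ (i, 0) * cnj (P $$ (j, 0))"
    using P mat_adjoint_carrier[OF P] i j by (simp add: scalar_prod_def mat_adjoint_index)
  then show ?thesis using i j by (simp add: Pi)
qed

section \<open>Frobenius bound for the moment terms\<close>

lemma diag_mult_le_frobenius_norm:
  assumes G: "G \<in> carrier_mat l l" and i: "i < l" and j: "j < l"
  shows "cmod (G $$ (i, i)) * cmod (G $$ (j, j)) \<le> (frobenius_norm G)\<^sup>2"
proof -
  let ?g = "\<lambda>s t. (cmod (G $$ (s, t)))\<^sup>2"
  have F: "(frobenius_norm G)\<^sup>2 = (\<Sum>s<l. \<Sum>t<l. ?g s t)"
    using G unfolding frobenius_norm_def by (simp add: sum_nonneg)
  \<comment> \<open>Summing over the set \<open>{i, j}\<close> counts a repeated index once, so the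
    sum stays below the full diagonal sum even for \<open>i = j\<close>, where equality holds. For
    distinct indices the bound is the arithmetic-geometric mean inequality with a factor 2 to
    spare.\<close>
  have "cmod (G $$ (i, i)) * cmod (G $$ (j, j)) \<le> (\<Sum>s\<in>{i, j}. ?g s s)"
  proof (cases "i = j")
    case False
    have "2 * (cmod (G $$ (i, i)) * cmod (G $$ (j, j))) \<le> ?g i i + ?g j j"
      using sum_squares_bound[of "cmod (G $$ (i, i))" "cmod (G $$ (j, j))"] by (simp add: mult.assoc)
    moreover have "0 \<le> cmod (G $$ (i, i)) * cmod (G $$ (j, j))" by simp
    ultimately have "cmod (G $$ (i, i)) * cmod (G $$ (j, j)) \<le> ?g i i + ?g j j" by linarith
    then show ?thesis using False by simp
  qed (simp add: power2_eq_square)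
  also have "\<dots> \<le> (\<Sum>s<l. ?g s s)"
    using i j by (intro sum_mono2) auto
  also have "\<dots> \<le> (\<Sum>s<l. \<Sum>t<l. ?g s t)"
    by (intro sum_mono member_le_sum) auto
  finally show ?thesis by (simp add: F)
qed

text \<open>In the coordinates \<open>Y\<close>, the squared modulus of the entry is a product of
  two numbers, one for each of \<open>i\<close> and \<open>j\<close>. Each of them is a single
  summand of the corresponding diagonal entry of \<open>G\<close>, and all summands there are
  nonnegative.\<close>

lemma moment_term_le_frobenius_norm:
  assumes r: "r \<le> n" and B: "B \<in> carrier_mat n n" "hermitian_mat B"
    and X: "X \<in> carrier_mat n n" "invertible_mat X"
    and cong: "mat_adjoint X * B * X = partial_id_mat n r"
    and V: "V \<in> carrier_mat n l" and k: "k < r" and i: "i < l" and j: "j < l"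
  shows "cmod (moment_term B V (col X k) $$ (i, j)) \<le> frobenius_norm (mat_adjoint V * B * V)"
proof -
  obtain Y where Y: "Y \<in> carrier_mat n l" and VXY: "V = X * Y"
    using invertible_mat_factor[OF X V] .
  note adj = mat_adjoint_carrier[OF V] mat_adjoint_carrier[OF X(1)] mat_adjoint_carrier[OF Y]
  define G where "G = mat_adjoint V * B * V"
  have G: "G \<in> carrier_mat l l" using adj V by (auto simp: G_def)
  have "G = mat_adjoint Y * mat_adjoint X * B * (X * Y)"
    by (simp add: G_def VXY mat_adjoint_mult[OF X(1) Y])
  also have "\<dots> = mat_adjoint Y * (mat_adjoint X * B * X) * Y"
    using assoc_mult_mat[OF adj(3,2) B(1)]
      assoc_mult_mat[OF adj(3) mult_carrier_mat[OF adj(2) B(1)] X(1)]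
      assoc_mult_mat[OF mult_carrier_mat[OF adj(3) mult_carrier_mat[OF adj(2) B(1)]] X(1) Y]
    by simp
  finally have GY: "G = mat_adjoint Y * partial_id_mat n r * Y" by (simp add: cong)
  have diag: "(cmod (Y $$ (k, s)))\<^sup>2 \<le> cmod (G $$ (s, s))" if "s < l" for s
  proof -
    have "(cmod (Y $$ (k, s)))\<^sup>2 \<le> (\<Sum>t<r. (cmod (Y $$ (t, s)))\<^sup>2)"
      using k by (intro member_le_sum) auto
    also have "\<dots> = cmod (G $$ (s, s))"
      unfolding GY gram_diag_index[OF r Y that] norm_of_real by (simp add: sum_nonneg)
    finally show ?thesis .
  qed
  have "(cmod (moment_term B V (col X k) $$ (i, j)))\<^sup>2
      = (cmod (Y $$ (k, i)))\<^sup>2 * (cmod (Y $$ (k, j)))\<^sup>2"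
    using moment_term_index[OF B X(1) cong Y VXY _ k i j] k r
    by (simp add: norm_mult power_mult_distrib)
  also have "\<dots> \<le> cmod (G $$ (i, i)) * cmod (G $$ (j, j))"
    by (intro mult_mono diag i j) auto
  also have "\<dots> \<le> (frobenius_norm G)\<^sup>2"
    by (rule diag_mult_le_frobenius_norm[OF G i j])
  finally show ?thesis
    unfolding G_def by (rule power2_le_imp_le) (simp add: frobenius_norm_def sum_nonneg)
qed

section \<open>Bound on the scalar filter weights\<close>

lemma filter_weight_le:
  fixes \<rho> d e :: real
  assumes \<rho>: "0 < \<rho>" and e: "\<rho> < e" "e \<le> \<bar>d\<bar>" and N: "p \<le> N" "0 < N"
  shows "\<bar>d ^ p * (- ((\<rho> / d) ^ N) / (1 - (\<rho> / d) ^ N))\<bar>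
    \<le> e ^ p * ((\<rho> / e) ^ N / (1 - (\<rho> / e) ^ N))"
proof -
  have le: "(\<rho> / \<bar>d\<bar>) ^ s \<le> (\<rho> / e) ^ s" for s
    using \<rho> e by (intro power_mono divide_left_mono) auto
  have lt: "(\<rho> / e) ^ N < 1"
    using \<rho> e N by (simp add: power_less_one_iff)
  have abs: "\<bar>(\<rho> / d) ^ N\<bar> = (\<rho> / \<bar>d\<bar>) ^ N"
    using \<rho> by (simp add: power_abs)
  \<comment> \<open>The growing factor \<open>c ^ p\<close> is absorbed by \<open>p\<close> of the
    \<open>N\<close> decaying factors; what remains depends on \<open>c\<close> only through a
    nonnegative power of \<open>\<rho> / c\<close>, hence is antitone in \<open>c\<close>.\<close>
  have split: "c ^ p * (\<rho> / c) ^ N = \<rho> ^ p * (\<rho> / c) ^ (N - p)" if "0 < c" for c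
  proof -
    have "(\<rho> / c) ^ N = (\<rho> / c) ^ p * (\<rho> / c) ^ (N - p)"
      using N by (simp flip: power_add)
    then show ?thesis using that by (simp add: power_divide)
  qed
  have "\<bar>d ^ p * (- ((\<rho> / d) ^ N) / (1 - (\<rho> / d) ^ N))\<bar>
      = \<bar>d\<bar> ^ p * (\<rho> / \<bar>d\<bar>) ^ N / \<bar>1 - (\<rho> / d) ^ N\<bar>"
    by (simp only: abs_mult abs_divide abs_minus_cancel abs power_abs[of d] times_divide_eq_right)
  also have "\<dots> \<le> e ^ p * (\<rho> / e) ^ N / (1 - (\<rho> / e) ^ N)"
  proof (rule frac_le)
    show "\<bar>d\<bar> ^ p * (\<rho> / \<bar>d\<bar>) ^ N \<le> e ^ p * (\<rho> / e) ^ N"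
      using \<rho> e le[of "N - p"] by (simp add: split mult_left_mono)
    show "0 < 1 - (\<rho> / e) ^ N" using lt by simp
    \<comment> \<open>The sign of \<open>d\<close> is irrelevant: the reverse triangle inequality
      bounds the denominator below by one minus the modulus of the power.\<close>
    show "1 - (\<rho> / e) ^ N \<le> \<bar>1 - (\<rho> / d) ^ N\<bar>"
      using le[of N] abs by linarith
    show "0 \<le> e ^ p * (\<rho> / e) ^ N" using \<rho> e by simp
  qed
  finally show ?thesis by simp
qed

section \<open>Summation over the outer eigenvalues\<close>

theorem theorem3p3:
  fixes A B X Lam V C0 C1 X0 X1 :: "complex mat"
    and lam :: "nat \<Rightarrow> real"
    and a b \<gamma> \<rho> lam_hat :: real
    and n r m L M N p :: nat
  assumes A: "A \<in> carrier_mat n n" "hermitian_mat A"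
    and B: "B \<in> carrier_mat n n" "psd_mat B"
    and r: "r = vec_space.rank n B"
    and regular: "regular_pencil A B"
    and canonical: "pencil_canonical_form n r A B X Lam lam"
    and ab: "a < b"
    and endpoints: "\<not> pencil_eigenvalue A B (complex_of_real a)"
                   "\<not> pencil_eigenvalue A B (complex_of_real b)"
    and m: "m < r"
    and inside: "\<forall>k<m. lam k \<in> {a..b}"
    and outside: "\<forall>k\<in>{m..<r}. lam k \<notin> {a..b}"
    and \<gamma>: "\<gamma> = (a + b) / 2"
    and \<rho>: "\<rho> = (b - a) / 2"
    and pos: "0 < L" "0 < M" "0 < N"
    and X0: "X0 = mat_of_cols n (map (col X) [r..<n])"
    and X1: "X1 = mat_of_cols n (map (col X) [0..<r])"
    and X0_basis: "cols_form_basis n X0 (mat_kernel B)"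
    and X1_basis: "cols_form_basis n X1 (herm_orth_complement n (mat_kernel B))"
    and C0: "C0 \<in> carrier_mat (n - r) L"
    and C1: "C1 \<in> carrier_mat r L"
    and C1_cols: "\<forall>j<L. \<exists>k<r. C1 $$ (k, j) \<noteq> 0"
    and C1_rows: "\<forall>k<r. \<exists>j<L. C1 $$ (k, j) \<noteq> 0"
    and V: "V \<in> carrier_mat n L"
    and V_eq: "V = append_cols X0 X1 * (C0 @\<^sub>r C1)"
    and N: "2 * M - 1 < N"
    and p: "p \<le> 2 * M - 1"
    and lam_hat: "\<bar>lam_hat - \<gamma>\<bar> = Min ((\<lambda>k. \<bar>lam k - \<gamma>\<bar>) ` {m..<r})"
  shows "mat_le_scalar (abs_mat (moment_out m r \<gamma> \<rho> lam B X V N p))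
           (real (r - m) * \<bar>lam_hat - \<gamma>\<bar> ^ p *
            ((\<rho> / \<bar>lam_hat - \<gamma>\<bar>) ^ N / (1 - (\<rho> / \<bar>lam_hat - \<gamma>\<bar>) ^ N)) *
            frobenius_norm (mat_adjoint V * B * V))"
proof -
  define F where "F = frobenius_norm (mat_adjoint V * B * V)"
  define e where "e = \<bar>lam_hat - \<gamma>\<bar>"
  define w where "w k = (lam k - \<gamma>) ^ p *
    (- ((\<rho> / (lam k - \<gamma>)) ^ N) / (1 - (\<rho> / (lam k - \<gamma>)) ^ N))" for k
  define W where "W = e ^ p * ((\<rho> / e) ^ N / (1 - (\<rho> / e) ^ N))"
  have F0: "0 \<le> F" by (simp add: F_def frobenius_norm_def sum_nonneg)
  have rn: "r \<le> n" unfolding r by (rule vec_space.rank_le_nc[OF B(1)])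
  have X: "X \<in> carrier_mat n n" "invertible_mat X"
    using canonical unfolding pencil_canonical_form_def by auto
  have Bh: "hermitian_mat B" using B unfolding psd_mat_def by auto
  \<comment> \<open>Since \<open>m < r\<close>, the minimum is over a nonempty finite set and is
    attained, so \<open>e\<close> inherits the strict bound \<open>\<rho> < e\<close> from an actual
    outer eigenvalue.\<close>
  have e_in: "e \<in> (\<lambda>k. \<bar>lam k - \<gamma>\<bar>) ` {m..<r}"
    unfolding e_def lam_hat using m by (intro Min_in) auto
  have "\<rho> < \<bar>lam k - \<gamma>\<bar>" if "k \<in> {m..<r}" for k
  proof -
    have "lam k < a \<or> b < lam k" using outside[rule_format, OF that] by auto
    then show ?thesis using ab unfolding \<gamma> \<rho> by (auto simp: field_simps abs_if)
  qed
  with e_in have e: "\<rho> < e" by auto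
  have weight: "\<bar>w k\<bar> \<le> W" if "k \<in> {m..<r}" for k
    unfolding w_def W_def
  proof (rule filter_weight_le)
    show "e \<le> \<bar>lam k - \<gamma>\<bar>" unfolding e_def lam_hat using that by (intro Min_le) auto
  qed (use ab \<rho> e N p pos in auto)
  have entry: "cmod (moment_out m r \<gamma> \<rho> lam B X V N p $$ (i, j)) \<le> real (r - m) * W * F"
    if ij: "i < L" "j < L" for i j
  proof -
    have dims: "moment_term B V (col X k) \<in> carrier_mat L L" for k
      using V mat_adjoint_carrier[OF V] by (auto simp: moment_term_def Let_def)
    have "cmod (moment_out m r \<gamma> \<rho> lam B X V N p $$ (i, j))
        = cmod (\<Sum>k\<in>{m..<r}. complex_of_real (w k) * moment_term B V (col X k) $$ (i, j))"
      using ij V carrier_matD[OF dims] by (simp add: moment_out_def w_def)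
    \<comment> \<open>The triangle inequality with a bound independent of \<open>k\<close>: the
      \<open>r - m\<close> equal summands give the factor \<open>real (r - m)\<close>.\<close>
    also have "\<dots> \<le> (\<Sum>k\<in>{m..<r}. W * F)"
    proof (rule sum_norm_le)
      fix k assume k: "k \<in> {m..<r}"
      then have "cmod (moment_term B V (col X k) $$ (i, j)) \<le> F"
        unfolding F_def
        using moment_term_le_frobenius_norm[OF rn B(1) Bh X
            canonical_form_congruence[OF A(1) B(1) canonical] V _ ij] by auto
      then show "cmod (complex_of_real (w k) * moment_term B V (col X k) $$ (i, j)) \<le> W * F"
        using weight[OF k] by (simp add: norm_mult mult_mono')
    qed
    finally show ?thesis by simp
  qed
  have "moment_out m r \<gamma> \<rho> lam B X V N p \<in> carrier_mat L L"
    using V by (simp add: moment_out_def)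
  then show ?thesis
    using entry unfolding mat_le_scalar_def abs_mat_def F_def[symmetric] e_def[symmetric] W_def
    by (auto simp: mult.assoc)
qed

end
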